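(* Let $x(t)\in\mathcal{C}^{r+2}(0,t_f)$ for some $r\in\mathbb{Z}^+$. Let $x_M(t)$ be the composite Bernstein polynomial approximation of $x(t)$ with $K$ segments of order $N$ (defined in the context). The following bound holds for all $t\in[0,t_f]$: $$\Vert x_M^{(r)}(t)-x^{(r)}(t)\Vert\le\frac{B_1}{K^2N}+\frac{B_2}{KN}+\frac{B_3}{N},$$ where $x^{(r)}(t)$ denotes the $r$th derivative of $x(t)$, and $B_1$, $B_2$ and $B_3$ are constants independent of both $K$ and $N$: $$B_1=\frac{C_t^2(r^2+1)}{2}\max_{\tau\in[t_{k-1},t_k],\ k=1,\dots,K}\Vert x^{(r+2)}(\tau)\Vert,$$ $$B_2=\frac{C_t r^2}{2}\max_{\tau\in[t_{k-1},t_k],\ k=1,\dots,K}\Vert x^{(r+1)}(t_{k-1})\Vert,$$ $$B_3=\frac{r(r-1)}{2}\max_{\tau\in[t_{k-1},t_k],\ k=1,\dots,K}\Vert x^{(r)}(t_{k-1})\Vert.$$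
   Context: The function $x$ is defined over $[0,t_f]$. The time knots $t_0<t_1<\dots<t_K$ satisfy $t_0=0$, $t_K=t_f$ and $|t_k-t_{k-1}|\le\frac{C_t}{K}$ for all $k=1,\dots,K$, where $C_t>0$ is independent of $K$. For $k=1,\dots,K$ and $j=0,\dots,N$, the Bernstein basis of degree $N$ on $I_k=[t_{k-1},t_k]$ is $$b_{j,N}^{[k]}(t)=\binom{N}{j}\frac{(t-t_{k-1})^j(t_k-t)^{N-j}}{(t_k-t_{k-1})^N}.$$ With $t_{k,j}=t_{k-1}+\frac{j}{N}(t_k-t_{k-1})$, the composite Bernstein approximant of $x$ is $$x_M(t)=\sum_{j=0}^N x(t_{k,j})\,b_{j,N}^{[k]}(t),\qquad t\in I_k,\ k=1,\dots,K,$$ where $M+1=K(N+1)$. Derivatives of $x_M$ are computed segment by segment, i.e. on each $I_k$ by differentiating the polynomial $\sum_{j=0}^N x(t_{k,j})b_{j,N}^{[k]}(t)$.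
   Formalization: B2 and B3, being maxima over the knots, do depend on K; they are shown bounded by constants independent of K, N and the knots (B1 is truly independent). x is taken C^{r+2} on the closed interval [0,t_f], so that the endpoint derivatives and maxima exist. *)

theory Defs
  imports "HOL-Analysis.Analysis"
begin

text \<open>Derivatives are taken within a set \<open>S\<close>, so that they are one-sided at the endpoints of an
  interval.\<close>

primrec nth_deriv_on :: "nat \<Rightarrow> real set \<Rightarrow> (real \<Rightarrow> 'a::real_normed_vector) \<Rightarrow> real \<Rightarrow> 'a" where
  "nth_deriv_on 0 S f = f"
| "nth_deriv_on (Suc n) S f = (\<lambda>t. vector_derivative (nth_deriv_on n S f) (at t within S))"

definition Ck_on :: "nat \<Rightarrow> real set \<Rightarrow> (real \<Rightarrow> 'a::real_normed_vector) \<Rightarrow> bool" where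
  "Ck_on n S f \<longleftrightarrow>
     (\<forall>i<n. \<forall>t\<in>S. nth_deriv_on i S f differentiable (at t within S)) \<and>
     continuous_on S (nth_deriv_on n S f)"

definition time_knots :: "real \<Rightarrow> real \<Rightarrow> nat \<Rightarrow> (nat \<Rightarrow> real) \<Rightarrow> bool" where
  "time_knots tf Ct K \<tau> \<longleftrightarrow>
     1 \<le> K \<and> \<tau> 0 = 0 \<and> \<tau> K = tf \<and>
     (\<forall>k\<in>{1..K}. \<tau> (k - 1) < \<tau> k \<and> \<bar>\<tau> k - \<tau> (k - 1)\<bar> \<le> Ct / real K)"

definition segment :: "(nat \<Rightarrow> real) \<Rightarrow> nat \<Rightarrow> real set" where
  "segment \<tau> k = {\<tau> (k - 1)..\<tau> k}"

definition bernstein_basis :: "real \<Rightarrow> real \<Rightarrow> nat \<Rightarrow> nat \<Rightarrow> real \<Rightarrow> real" where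
  "bernstein_basis a b N j t =
     real (N choose j) * ((t - a) ^ j * (b - t) ^ (N - j)) / (b - a) ^ N"

definition bernstein_approx :: "(real \<Rightarrow> 'a::real_normed_vector) \<Rightarrow> real \<Rightarrow> real \<Rightarrow> nat \<Rightarrow> real \<Rightarrow> 'a" where
  "bernstein_approx x a b N t =
     (\<Sum>j=0..N. bernstein_basis a b N j t *\<^sub>R x (a + real j / real N * (b - a)))"

text \<open>At an interior knot the two adjacent segment polynomials agree, so choosing the first segment
  containing \<open>t\<close> is immaterial; see \<open>composite_bernstein_eq\<close>.\<close>

definition composite_bernstein ::
    "(real \<Rightarrow> 'a::real_normed_vector) \<Rightarrow> (nat \<Rightarrow> real) \<Rightarrow> nat \<Rightarrow> nat \<Rightarrow> real \<Rightarrow> 'a" where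
  "composite_bernstein x \<tau> K N t =
     (let k = (LEAST k. k \<in> {1..K} \<and> t \<in> segment \<tau> k)
      in bernstein_approx x (\<tau> (k - 1)) (\<tau> k) N t)"

text \<open>The supremum in \<open>B1_const\<close> is a maximum when \<open>x\<close> is of class \<open>C\<^sup>r\<^sup>+\<^sup>2\<close>. The quantities in
  \<open>B2_const\<close> and \<open>B3_const\<close> depend only on the index of the segment.\<close>

definition B1_const :: "(real \<Rightarrow> 'a::real_normed_vector) \<Rightarrow> real \<Rightarrow> real \<Rightarrow> nat \<Rightarrow> (nat \<Rightarrow> real) \<Rightarrow> nat \<Rightarrow> real" where
  "B1_const x tf Ct K \<tau> r =
     Ct\<^sup>2 * (real r ^ 2 + 1) / 2 *
     (SUP s\<in>(\<Union>k\<in>{1..K}. segment \<tau> k). norm (nth_deriv_on (r + 2) {0..tf} x s))"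

definition B2_const :: "(real \<Rightarrow> 'a::real_normed_vector) \<Rightarrow> real \<Rightarrow> real \<Rightarrow> nat \<Rightarrow> (nat \<Rightarrow> real) \<Rightarrow> nat \<Rightarrow> real" where
  "B2_const x tf Ct K \<tau> r =
     Ct * real r ^ 2 / 2 *
     (MAX k\<in>{1..K}. norm (nth_deriv_on (r + 1) {0..tf} x (\<tau> (k - 1))))"

definition B3_const :: "(real \<Rightarrow> 'a::real_normed_vector) \<Rightarrow> real \<Rightarrow> nat \<Rightarrow> (nat \<Rightarrow> real) \<Rightarrow> nat \<Rightarrow> real" where
  "B3_const x tf K \<tau> r =
     real r * (real r - 1) / 2 *
     (MAX k\<in>{1..K}. norm (nth_deriv_on r {0..tf} x (\<tau> (k - 1))))"

lemma bernstein_basis_eq_Bernstein: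
  assumes "a < b" "j \<le> N"
  shows "bernstein_basis a b N j t = Bernstein N j ((t - a) / (b - a))"
proof -
  have 1: "1 - (t - a) / (b - a) = (b - t) / (b - a)"
    using assms by (simp add: field_simps)
  have 2: "(b - a) ^ N = (b - a) ^ j * (b - a) ^ (N - j)"
    using assms by (simp flip: power_add)
  show ?thesis
    unfolding bernstein_basis_def Bernstein_def 1 2 by (simp add: power_divide)
qed

lemma bernstein_approx_left:
  assumes "a < b"
  shows "bernstein_approx x a b N a = x a"
proof -
  have "bernstein_approx x a b N a
      = (\<Sum>j=0..N. if j = 0 then x a else 0)"
    unfolding bernstein_approx_def bernstein_basis_def
    using assms by (intro sum.cong) auto
  then show ?thesis by simp
qed

lemma bernstein_approx_right:
  assumes "a < b" "1 \<le> N"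
  shows "bernstein_approx x a b N b = x b"
proof -
  have "bernstein_approx x a b N b
      = (\<Sum>j=0..N. if j = N then x b else 0)"
    unfolding bernstein_approx_def bernstein_basis_def
    using assms by (intro sum.cong) auto
  then show ?thesis by simp
qed

lemma time_knots_mono:
  assumes "time_knots tf Ct K \<tau>" "i \<le> j" "j \<le> K"
  shows "\<tau> i \<le> \<tau> j"
  using assms(2,3)
proof (induction j rule: dec_induct)
  case (step n)
  have "\<tau> (Suc n - 1) < \<tau> (Suc n)"
    using assms(1) step unfolding time_knots_def by (metis Suc_le_eq atLeastAtMost_iff le_add1 plus_1_eq_Suc)
  with step show ?case by simp
qed simp

lemma composite_bernstein_eq:
  assumes kn: "time_knots tf Ct K \<tau>" and N: "1 \<le> N"
    and k: "k \<in> {1..K}" and t: "t \<in> segment \<tau> k"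
  shows "composite_bernstein x \<tau> K N t = bernstein_approx x (\<tau> (k - 1)) (\<tau> k) N t"
proof -
  define m where "m = (LEAST k. k \<in> {1..K} \<and> t \<in> segment \<tau> k)"
  have m: "m \<in> {1..K}" "t \<in> segment \<tau> m"
    using LeastI[of "\<lambda>k. k \<in> {1..K} \<and> t \<in> segment \<tau> k" k] k t
    unfolding m_def by blast+
  have le: "m \<le> k"
    unfolding m_def using k t by (intro Least_le) auto
  have lt: "\<tau> (i - 1) < \<tau> i" if "i \<in> {1..K}" for i
    using kn that by (auto simp: time_knots_def)
  have "bernstein_approx x (\<tau> (m - 1)) (\<tau> m) N t = bernstein_approx x (\<tau> (k - 1)) (\<tau> k) N t"
  proof (cases "m = k")
    case False
    with le have mk: "m \<le> k - 1" "m < k" by auto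
    have "\<tau> m \<le> \<tau> (k - 1)"
      using time_knots_mono[OF kn mk(1)] k by auto
    with m t have eq: "t = \<tau> m" "t = \<tau> (k - 1)"
      by (auto simp: segment_def)
    have "bernstein_approx x (\<tau> (m - 1)) (\<tau> m) N t = x t"
      using bernstein_approx_right[OF lt[OF m(1)] N] eq(1) by simp
    moreover have "bernstein_approx x (\<tau> (k - 1)) (\<tau> k) N t = x t"
      using bernstein_approx_left[OF lt[OF k]] eq(2) by simp
    ultimately show ?thesis by simp
  qed simp
  then show ?thesis
    unfolding composite_bernstein_def Let_def m_def .
qed

lemma nth_deriv_on_cong:
  assumes "\<And>s. s \<in> S \<Longrightarrow> f s = g s" "t \<in> S"
  shows "nth_deriv_on n S f t = nth_deriv_on n S g t"
  using assms(2)
proof (induction n arbitrary: t)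
  case 0
  then show ?case using assms(1) by simp
next
  case (Suc n)
  have "(nth_deriv_on n S f has_vector_derivative D) (at t within S) \<longleftrightarrow>
        (nth_deriv_on n S g has_vector_derivative D) (at t within S)" for D
    using Suc has_vector_derivative_transform[of t S "nth_deriv_on n S g" "nth_deriv_on n S f" D]
      has_vector_derivative_transform[of t S "nth_deriv_on n S f" "nth_deriv_on n S g" D]
    by auto
  then show ?case by (simp add: vector_derivative_def)
qed

text \<open>Hence the derivative of the composite approximant within a segment is the derivative of the
  polynomial on that segment.\<close>

lemma nth_deriv_on_composite_bernstein:
  assumes "time_knots tf Ct K \<tau>" "1 \<le> N" "k \<in> {1..K}" "t \<in> segment \<tau> k"
  shows "nth_deriv_on n (segment \<tau> k) (composite_bernstein x \<tau> K N) t =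
         nth_deriv_on n (segment \<tau> k) (bernstein_approx x (\<tau> (k - 1)) (\<tau> k) N) t"
  using assms by (intro nth_deriv_on_cong composite_bernstein_eq) auto

lemma time_knots_segments_cover:
  assumes "time_knots tf Ct K \<tau>"
  shows "(\<Union>k\<in>{1..K}. segment \<tau> k) = {0..tf}"
proof -
  have K: "1 \<le> K" "\<tau> 0 = 0" "\<tau> K = tf"
    using assms by (auto simp: time_knots_def)
  have "segment \<tau> k \<subseteq> {0..tf}" if "k \<in> {1..K}" for k
    using time_knots_mono[OF assms, of 0 "k - 1"] time_knots_mono[OF assms, of k K] that K
    by (auto simp: segment_def)
  moreover have "\<exists>k\<in>{1..K}. t \<in> segment \<tau> k" if "t \<in> {0..tf}" for t
  proof -
    define m where "m = (LEAST k. 1 \<le> k \<and> t \<le> \<tau> k)"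
    have ex: "1 \<le> K \<and> t \<le> \<tau> K" using K that by auto
    have m: "1 \<le> m" "t \<le> \<tau> m" "m \<le> K"
      using LeastI[of "\<lambda>k. 1 \<le> k \<and> t \<le> \<tau> k", OF ex] Least_le[of "\<lambda>k. 1 \<le> k \<and> t \<le> \<tau> k", OF ex]
      unfolding m_def by auto
    have "\<tau> (m - 1) \<le> t"
    proof (cases "m = 1")
      case True
      then show ?thesis using K that by simp
    next
      case False
      then show ?thesis
        using not_less_Least[of "m - 1" "\<lambda>k. 1 \<le> k \<and> t \<le> \<tau> k"] m(1)
        unfolding m_def[symmetric] by linarith
    qed
    with m show ?thesis by (auto simp: segment_def)
  qed
  ultimately show ?thesis by blast
qed

end

theory Submission
  imports Defs
begin

text \<open>
  On a segment of length \<open>h\<close> put \<open>\<delta> = h / N\<close>, \<open>g = x\<^sup>(\<^sup>r\<^sup>)\<close> and \<open>u = (t - a) / h\<close>. For \<open>r \<le> N\<close> the \<open>r\<close>-th derivative of the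
  Bernstein approximant is \<open>\<kappa> = N! / ((N - r)! N\<^sup>r)\<close> times a Bernstein average of degree \<open>N - r\<close> of
  the difference quotients \<open>\<Delta>\<^sup>r x / \<delta>\<^sup>r\<close> at the nodes. Replacing \<open>g\<close> by its tangent at \<open>t\<close> makes the
  average explicit: it is \<open>g(t) + \<delta> r (1/2 - u) g'(t)\<close>, up to a remainder controlled by \<open>max |g''|\<close>
  and the second moments of the Bernstein weights. Together with \<open>1 - \<kappa> \<le> r(r - 1)/(2N)\<close>,
  the error is at most a combination of \<open>|g(t)|\<close>, \<open>|g'(t)|\<close> and \<open>max |g''|\<close>; expanding \<open>g\<close> and \<open>g'\<close>
  at the left end of the segment yields exactly the stated constants. For \<open>N < r\<close> one has \<open>\<kappa> = 0\<close>,
  the approximant has vanishing \<open>r\<close>-th derivative, and the term \<open>r(r - 1)/(2N) |g(t)|\<close> alone suffices.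
\<close>

section \<open>Bernstein forms on the unit interval and their derivatives\<close>

text \<open>The coefficients form an infinite sequence of which only indices up to \<open>n\<close>
  enter, so that shifts and differences compose without tracking lengths.\<close>

definition bernstein_form :: "nat \<Rightarrow> (nat \<Rightarrow> 'a::real_normed_vector) \<Rightarrow> real \<Rightarrow> 'a" where
  "bernstein_form n c u = (\<Sum>j\<le>n. Bernstein n j u *\<^sub>R c j)"

definition fwd_diff :: "(nat \<Rightarrow> 'a::ab_group_add) \<Rightarrow> nat \<Rightarrow> 'a" where
  "fwd_diff c j = c (Suc j) - c j"

lemma Bernstein_Suc_0: "Bernstein (Suc n) 0 u = (1 - u) * Bernstein n 0 u"
  by (simp add: Bernstein_def)

lemma Bernstein_eq_0: "n < j \<Longrightarrow> Bernstein n j u = 0"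
  by (simp add: Bernstein_def)

lemma Bernstein_Suc_Suc:
  assumes "j \<le> n"
  shows "Bernstein (Suc n) (Suc j) u = u * Bernstein n j u + (1 - u) * Bernstein n (Suc j) u"
proof (cases "j = n")
  case False
  then have "n - j = Suc (n - Suc j)"
    using assms by auto
  moreover define w where "w = 1 - u"
  ultimately have "w ^ (n - j) = w * w ^ (n - Suc j)"
    by simp
  then show ?thesis
    by (simp add: Bernstein_def flip: w_def) (simp add: algebra_simps)
qed (simp add: Bernstein_def)

text \<open>One step of de Casteljau's algorithm: index 0 is split off and Pascal's rule for the
  basis polynomials is applied to the rest. It drives the induction on the degree in the derivative
  formula.\<close>

lemma bernstein_form_de_Casteljau:
  "bernstein_form (Suc n) c u =
     (1 - u) *\<^sub>R bernstein_form n c u + u *\<^sub>R bernstein_form n (\<lambda>j. c (Suc j)) u"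
proof -
  have "(\<Sum>j\<le>n. Bernstein n j u *\<^sub>R c j) = (\<Sum>j\<le>Suc n. Bernstein n j u *\<^sub>R c j)"
    by (simp add: Bernstein_eq_0)
  also have "\<dots> = Bernstein n 0 u *\<^sub>R c 0 + (\<Sum>j\<le>n. Bernstein n (Suc j) u *\<^sub>R c (Suc j))"
    by (rule sum.atMost_Suc_shift)
  finally have 1: "bernstein_form n c u =
      Bernstein n 0 u *\<^sub>R c 0 + (\<Sum>j\<le>n. Bernstein n (Suc j) u *\<^sub>R c (Suc j))"
    by (simp add: bernstein_form_def)
  have "bernstein_form (Suc n) c u =
      Bernstein (Suc n) 0 u *\<^sub>R c 0 + (\<Sum>j\<le>n. Bernstein (Suc n) (Suc j) u *\<^sub>R c (Suc j))"
    unfolding bernstein_form_def by (rule sum.atMost_Suc_shift)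
  also have "(\<Sum>j\<le>n. Bernstein (Suc n) (Suc j) u *\<^sub>R c (Suc j)) =
      u *\<^sub>R bernstein_form n (\<lambda>j. c (Suc j)) u
      + (1 - u) *\<^sub>R (\<Sum>j\<le>n. Bernstein n (Suc j) u *\<^sub>R c (Suc j))"
    by (simp add: bernstein_form_def Bernstein_Suc_Suc scaleR_sum_right scaleR_add_left sum.distrib)
  finally show ?thesis
    by (simp add: 1 Bernstein_Suc_0 scaleR_add_right)
qed

lemma bernstein_form_fwd_diff:
  "bernstein_form n (fwd_diff c) u = bernstein_form n (\<lambda>j. c (Suc j)) u - bernstein_form n c u"
  by (simp add: bernstein_form_def fwd_diff_def scaleR_diff_right sum_subtractf)

text \<open>By de Casteljau and the product rule: the derivatives of the two forms of degree
  \<open>n\<close> recombine into \<open>n\<close> copies of the form of the differences, and the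
  derivatives of the weights \<open>1 - u\<close> and \<open>u\<close> give one more. For
  \<open>n = 0\<close> the truncated degree \<open>n - 1\<close> is multiplied by zero.\<close>

lemma bernstein_form_has_vector_derivative:
  "(bernstein_form n c has_vector_derivative real n *\<^sub>R bernstein_form (n - 1) (fwd_diff c) u)
     (at u within S)"
proof (induction n arbitrary: c)
  case 0
  have "bernstein_form 0 c = (\<lambda>_. c 0)"
    by (simp add: bernstein_form_def Bernstein_def fun_eq_iff)
  then show ?case by simp
next
  case (Suc n)
  let ?s = "\<lambda>j. c (Suc j)"
  have eq: "bernstein_form (Suc n) c = (\<lambda>u. (1 - u) *\<^sub>R bernstein_form n c u + u *\<^sub>R bernstein_form n ?s u)"
    by (rule ext) (rule bernstein_form_de_Casteljau)
  have s: "fwd_diff ?s = (\<lambda>j. fwd_diff c (Suc j))"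
    by (simp add: fwd_diff_def fun_eq_iff)
  have "(bernstein_form (Suc n) c has_vector_derivative
      ((1 - u) *\<^sub>R (real n *\<^sub>R bernstein_form (n - 1) (fwd_diff c) u) + (- 1) *\<^sub>R bernstein_form n c u)
      + (u *\<^sub>R (real n *\<^sub>R bernstein_form (n - 1) (fwd_diff ?s) u) + 1 *\<^sub>R bernstein_form n ?s u))
      (at u within S)"
    unfolding eq
    by (intro has_vector_derivative_add has_vector_derivative_scaleR Suc) (auto intro!: derivative_eq_intros)
  moreover have "real n *\<^sub>R ((1 - u) *\<^sub>R bernstein_form (n - 1) (fwd_diff c) u
      + u *\<^sub>R bernstein_form (n - 1) (fwd_diff ?s) u) = real n *\<^sub>R bernstein_form n (fwd_diff c) u"
    by (cases n) (simp_all add: s bernstein_form_de_Casteljau)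
  moreover have "(1 - u) *\<^sub>R m *\<^sub>R X + (- 1) *\<^sub>R P + (u *\<^sub>R m *\<^sub>R Y + 1 *\<^sub>R Q) =
      m *\<^sub>R ((1 - u) *\<^sub>R X + u *\<^sub>R Y) + (Q - P)" for m :: real and X Y P Q :: 'a
    by (simp add: algebra_simps)
  moreover have "real n *\<^sub>R bernstein_form n (fwd_diff c) u
      + (bernstein_form n ?s u - bernstein_form n c u) = real (Suc n) *\<^sub>R bernstein_form n (fwd_diff c) u"
    by (simp add: bernstein_form_fwd_diff[symmetric] scaleR_add_left)
  ultimately show ?case
    by (simp only:) simp
qed

section \<open>One-sided iterated derivatives of the approximant\<close>

text \<open>Derivatives within a nondegenerate closed interval are unique, so a guessed chain
  \<open>F\<close> can be verified one differentiation at a time.\<close>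

lemma nth_deriv_on_eqI:
  assumes "a < b"
    and "\<And>t. t \<in> {a..b} \<Longrightarrow> F 0 t = f t"
    and "\<And>i t. t \<in> {a..b} \<Longrightarrow> (F i has_vector_derivative F (Suc i) t) (at t within {a..b})"
    and "t \<in> {a..b}"
  shows "nth_deriv_on n {a..b} f t = F n t"
  using assms(4)
proof (induction n arbitrary: t)
  case 0
  then show ?case using assms(2) by simp
next
  case (Suc n)
  have "(nth_deriv_on n {a..b} f has_vector_derivative F (Suc n) t) (at t within {a..b})"
    using has_vector_derivative_transform[OF Suc.prems Suc.IH assms(3)[OF Suc.prems]] by auto
  then show ?case
    using vector_derivative_within_cbox[of a b t] assms(1) Suc.prems by auto
qed

text \<open>Each differentiation contributes \<open>1 / (b - a)\<close> by the chain rule, a factor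
  \<open>N - i\<close> and one forward difference. Natural subtraction makes the product vanish once
  \<open>n > N\<close>, so the formula covers that case as well.\<close>

lemma nth_deriv_on_bernstein_approx:
  assumes "a < b" "t \<in> {a..b}"
  shows "nth_deriv_on n {a..b} (bernstein_approx x a b N) t =
    ((\<Prod>i<n. real (N - i)) / (b - a) ^ n) *\<^sub>R
      bernstein_form (N - n) ((fwd_diff ^^ n) (\<lambda>j. x (a + real j / real N * (b - a)))) ((t - a) / (b - a))"
    (is "_ = ?F n t")
proof (rule nth_deriv_on_eqI[OF assms(1) _ _ assms(2)])
  fix t
  show "?F 0 t = bernstein_approx x a b N t"
    by (simp add: bernstein_form_def bernstein_approx_def bernstein_basis_eq_Bernstein[OF assms(1)] atLeast0AtMost)
next
  fix i t
  let ?c = "(fwd_diff ^^ i) (\<lambda>j. x (a + real j / real N * (b - a)))"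
  have "b - a \<noteq> 0"
    using assms(1) by simp
  then have "((\<lambda>t. (t - a) / (b - a)) has_vector_derivative 1 / (b - a)) (at t within {a..b})"
    unfolding has_real_derivative_iff_has_vector_derivative[symmetric]
    by (auto intro!: derivative_eq_intros)
  from vector_diff_chain_within[OF this bernstein_form_has_vector_derivative, of "N - i" ?c]
  have "((\<lambda>t. bernstein_form (N - i) ?c ((t - a) / (b - a))) has_vector_derivative
      (1 / (b - a)) *\<^sub>R (real (N - i) *\<^sub>R bernstein_form (N - i - 1) (fwd_diff ?c) ((t - a) / (b - a))))
      (at t within {a..b})"
    unfolding o_def .
  then have "(?F i has_vector_derivative ((\<Prod>k<i. real (N - k)) / (b - a) ^ i) *\<^sub>R
      (1 / (b - a)) *\<^sub>R (real (N - i) *\<^sub>R bernstein_form (N - i - 1) (fwd_diff ?c) ((t - a) / (b - a))))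
      (at t within {a..b})"
    by (intro bounded_linear.has_vector_derivative[OF bounded_linear_scaleR_right])
  then show "(?F i has_vector_derivative ?F (Suc i) t) (at t within {a..b})"
    by (simp add: mult.commute[of "(b - a) ^ i"])
qed

section \<open>Mean value inequality and iterated differences\<close>

text \<open>Vector values admit no mean value equality, so growth is compared with that of a real
  function \<open>g\<close>. In the interior the derivatives within the interval are
  two-sided.\<close>

lemma norm_diff_le_of_deriv_le:
  fixes f :: "real \<Rightarrow> 'a::real_normed_vector"
  assumes "a \<le> b"
    and f: "\<And>z. z \<in> {a..b} \<Longrightarrow> (f has_vector_derivative f' z) (at z within {a..b})"
    and g: "\<And>z. z \<in> {a..b} \<Longrightarrow> (g has_vector_derivative g' z) (at z within {a..b})"
    and le: "\<And>z. z \<in> {a..b} \<Longrightarrow> norm (f' z) \<le> g' z"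
  shows "norm (f b - f a) \<le> g b - g a"
proof (cases "a = b")
  case False
  then have "a < b"
    using assms(1) by simp
  have at: "at z within {a..b} = at z" if "a < z" "z < b" for z
    using that by (intro at_within_interior) auto
  show ?thesis
  proof (rule differentiable_bound_general[OF \<open>a < b\<close>])
    show "continuous_on {a..b} f" "continuous_on {a..b} g"
      by (rule continuous_on_vector_derivative, fact f, rule continuous_on_vector_derivative, fact g)
    show "(f has_vector_derivative f' z) (at z)" "(g has_vector_derivative g' z) (at z)"
      "norm (f' z) \<le> g' z" if "a < z" "z < b" for z
      using f[of z] g[of z] le[of z] at[OF that] that by simp_all
  qed
qed simp

text \<open>For an affine \<open>r\<close>-th derivative the \<open>r\<close>-fold difference is exact, with the value at the midpoint
  of the nodes; this is what makes the bound of second order.\<close>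

lemma fwd_diff_funpow_approx:
  fixes \<phi> :: "nat \<Rightarrow> real \<Rightarrow> 'a::real_normed_vector"
  assumes "0 < d"
    and "p = q + real j * d"
    and "\<And>i y. i < r \<Longrightarrow> y \<in> {p..p + real r * d} \<Longrightarrow>
           (\<phi> i has_vector_derivative \<phi> (Suc i) y) (at y within {p..p + real r * d})"
    and "\<And>y. y \<in> {p..p + real r * d} \<Longrightarrow> norm (\<phi> r y - (A + (y - p) *\<^sub>R B)) \<le> E"
  shows "norm ((fwd_diff ^^ r) (\<lambda>i. \<phi> 0 (q + real i * d)) j - d ^ r *\<^sub>R (A + (real r * d / 2) *\<^sub>R B))
           \<le> d ^ r * E"
  using assms(3,4)
proof (induction r arbitrary: \<phi> A B E)
  case 0
  then show ?case using assms(2) by simp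
next
  case (Suc r)
  \<comment> \<open>One difference turns the chain \<open>\<phi>\<close> into a chain
    \<open>\<psi>\<close> on an interval shorter by \<open>d\<close>, to which the induction
    hypothesis applies with new \<open>A\<close>, \<open>B\<close> and \<open>E\<close>.\<close>
  define \<psi> where "\<psi> i y = \<phi> i (y + d) - \<phi> i y" for i y
  have sub: "y \<in> {p..p + real (Suc r) * d}" "y + d \<in> {p..p + real (Suc r) * d}"
    if "y \<in> {p..p + real r * d}" for y
    using that assms(1) by (auto simp: algebra_simps)
  have shift: "fwd_diff (\<lambda>i. \<phi> 0 (q + real i * d)) = (\<lambda>i. \<psi> 0 (q + real i * d))"
    by (simp add: fwd_diff_def \<psi>_def fun_eq_iff algebra_simps)
  have chain: "(\<psi> i has_vector_derivative \<psi> (Suc i) y) (at y within {p..p + real r * d})"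
    if "i < r" "y \<in> {p..p + real r * d}" for i y
  proof -
    let ?S = "{p..p + real r * d}" and ?T = "{p..p + real (Suc r) * d}"
    have "((\<lambda>y. y + d) has_vector_derivative 1) (at y within ?S)"
      unfolding has_real_derivative_iff_has_vector_derivative[symmetric]
      by (auto intro!: derivative_eq_intros)
    moreover have "(\<phi> i has_vector_derivative \<phi> (Suc i) (y + d)) (at (y + d) within (\<lambda>y. y + d) ` ?S)"
      by (rule has_vector_derivative_within_subset[OF Suc.prems(1)[OF _ sub(2)[OF that(2)]] image_subsetI[OF sub(2)]])
         (use that(1) in simp_all)
    ultimately have "((\<lambda>y. \<phi> i (y + d)) has_vector_derivative 1 *\<^sub>R \<phi> (Suc i) (y + d)) (at y within ?S)"
      by (rule vector_diff_chain_within[unfolded o_def])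
    then have "((\<lambda>y. \<phi> i (y + d)) has_vector_derivative \<phi> (Suc i) (y + d)) (at y within ?S)"
      by (simp only: scaleR_one)
    moreover have "(\<phi> i has_vector_derivative \<phi> (Suc i) y) (at y within ?S)"
      by (rule has_vector_derivative_within_subset[OF Suc.prems(1)[OF _ sub(1)[OF that(2)]] subsetI[OF sub(1)]])
         (use that(1) in simp_all)
    ultimately show ?thesis
      unfolding \<psi>_def by (intro has_vector_derivative_diff)
  qed
  \<comment> \<open>\<open>\<psi> r\<close> is the increment of \<open>\<phi> r\<close> over a step
    \<open>d\<close>. Integrating the affine model over that step gives an affine model again, with
    slope \<open>d *\<^sub>R B\<close>, and the error \<open>E\<close> becomes
    \<open>d * E\<close>.\<close>
  have bound: "norm (\<psi> r y - (d *\<^sub>R (A + (d / 2) *\<^sub>R B) + (y - p) *\<^sub>R d *\<^sub>R B)) \<le> d * E"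
    if y: "y \<in> {p..p + real r * d}" for y
  proof -
    let ?T = "{p..p + real (Suc r) * d}"
    define f where "f z = \<phi> r z - (z *\<^sub>R A + ((z - p)\<^sup>2 / 2) *\<^sub>R B)" for z
    have T: "{y..y + d} \<subseteq> ?T"
      using sub[OF y] by auto
    have "(f has_vector_derivative \<phi> (Suc r) z - (A + (z - p) *\<^sub>R B)) (at z within {y..y + d})"
      if "z \<in> {y..y + d}" for z
    proof -
      have "((\<lambda>z. (z - p)\<^sup>2 / 2) has_vector_derivative z - p) (at z within {y..y + d})"
        unfolding has_real_derivative_iff_has_vector_derivative[symmetric]
        by (auto intro!: derivative_eq_intros)
      then have AB: "((\<lambda>z. z *\<^sub>R A + ((z - p)\<^sup>2 / 2) *\<^sub>R B) has_vector_derivative 1 *\<^sub>R A + (z - p) *\<^sub>R B)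
          (at z within {y..y + d})"
        by (intro has_vector_derivative_add bounded_linear.has_vector_derivative[OF bounded_linear_scaleR_left]
              has_vector_derivative_id[unfolded id_def])
      have "(\<phi> r has_vector_derivative \<phi> (Suc r) z) (at z within {y..y + d})"
        by (rule has_vector_derivative_within_subset[OF Suc.prems(1)]) (use that T in auto)
      from has_vector_derivative_diff[OF this AB] show ?thesis
        unfolding f_def by (simp only: scaleR_one)
    qed
    then have "norm (f (y + d) - f y) \<le> (y + d) * E - y * E"
    proof (rule norm_diff_le_of_deriv_le[rotated])
      show "((\<lambda>z. z * E) has_vector_derivative E) (at z within {y..y + d})" for z
        unfolding has_real_derivative_iff_has_vector_derivative[symmetric]
        by (auto intro!: derivative_eq_intros)
    qed (use Suc.prems(2) T assms(1) in auto)
    moreover have "(y + d - p)\<^sup>2 / 2 = (y - p)\<^sup>2 / 2 + d * (d / 2) + (y - p) * d"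
      by (simp add: power2_eq_square field_simps)
    then have "f (y + d) - f y = \<psi> r y - (d *\<^sub>R (A + (d / 2) *\<^sub>R B) + (y - p) *\<^sub>R d *\<^sub>R B)"
      unfolding f_def \<psi>_def by (simp only:) (simp add: algebra_simps)
    moreover have "(y + d) * E - y * E = d * E"
      by (simp add: algebra_simps)
    ultimately show ?thesis
      by (simp only:)
  qed
  have "norm ((fwd_diff ^^ r) (\<lambda>i. \<psi> 0 (q + real i * d)) j
      - d ^ r *\<^sub>R (d *\<^sub>R (A + (d / 2) *\<^sub>R B) + (real r * d / 2) *\<^sub>R d *\<^sub>R B)) \<le> d ^ r * (d * E)"
    by (rule Suc.IH[where \<phi> = \<psi> and A = "d *\<^sub>R (A + (d / 2) *\<^sub>R B)" and B = "d *\<^sub>R B" and E = "d * E"])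
       (fact chain bound)+
  \<comment> \<open>Each difference moves the evaluation point by \<open>d / 2\<close>; the shifts
    add up to half the width of the block of nodes.\<close>
  moreover have "d *\<^sub>R (A + (d / 2) *\<^sub>R B) + (real r * d / 2) *\<^sub>R d *\<^sub>R B = d *\<^sub>R (A + (real (Suc r) * d / 2) *\<^sub>R B)"
    by (simp add: algebra_simps add_divide_distrib)
  ultimately show ?case
    unfolding funpow_Suc_right o_apply shift power_Suc2 mult.assoc scaleR_scaleR[symmetric] by (simp only:)
qed


section \<open>Lipschitz and Taylor bounds\<close>

lemma norm_diff_le_of_deriv_bounded:
  fixes f :: "real \<Rightarrow> 'a::real_normed_vector"
  assumes f: "\<And>z. z \<in> {a..b} \<Longrightarrow> (f has_vector_derivative f' z) (at z within {a..b})"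
    and M: "\<And>z. z \<in> {a..b} \<Longrightarrow> norm (f' z) \<le> M"
    and "u \<in> {a..b}" "y \<in> {a..b}"
  shows "norm (f y - f u) \<le> M * \<bar>y - u\<bar>"
proof -
  have *: "norm (f v - f u) \<le> M * (v - u)" if "u \<le> v" "{u..v} \<subseteq> {a..b}" for u v
  proof -
    have "norm (f v - f u) \<le> v * M - u * M"
    proof (rule norm_diff_le_of_deriv_le[OF that(1)])
      show "((\<lambda>z. z * M) has_vector_derivative M) (at z within {u..v})" for z
        unfolding has_real_derivative_iff_has_vector_derivative[symmetric]
        by (auto intro!: derivative_eq_intros)
      show "(f has_vector_derivative f' z) (at z within {u..v})" if "z \<in> {u..v}" for z
        by (rule has_vector_derivative_within_subset[OF f \<open>{u..v} \<subseteq> {a..b}\<close>])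
           (use that \<open>{u..v} \<subseteq> {a..b}\<close> in blast)
      show "norm (f' z) \<le> M" if "z \<in> {u..v}" for z
        by (rule M) (use that \<open>{u..v} \<subseteq> {a..b}\<close> in blast)
    qed
    then show ?thesis
      by (simp add: algebra_simps)
  qed
  show ?thesis
    using *[of u y] *[of y u] assms(3,4) by (cases "u \<le> y") (simp_all add: norm_minus_commute)
qed

text \<open>The mean value inequality is used twice: first to bound the change of \<open>f'\<close>
  by \<open>M * \<bar>z - u\<bar>\<close>, then to compare \<open>f\<close> minus its linear part at
  \<open>u\<close> with an antiderivative of that bound.\<close>

lemma norm_taylor_remainder_le:
  fixes f :: "real \<Rightarrow> 'a::real_normed_vector"
  assumes f: "\<And>z. z \<in> {a..b} \<Longrightarrow> (f has_vector_derivative f' z) (at z within {a..b})"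
    and f': "\<And>z. z \<in> {a..b} \<Longrightarrow> (f' has_vector_derivative f'' z) (at z within {a..b})"
    and M: "\<And>z. z \<in> {a..b} \<Longrightarrow> norm (f'' z) \<le> M"
    and u: "u \<in> {a..b}" and y: "y \<in> {a..b}"
  shows "norm (f y - (f u + (y - u) *\<^sub>R f' u)) \<le> M * (y - u)\<^sup>2 / 2"
proof -
  define g where "g z = f z - (z - u) *\<^sub>R f' u" for z
  have g: "(g has_vector_derivative f' z - f' u) (at z within T)" if "z \<in> T" "T \<subseteq> {a..b}" for z T
  proof -
    have "((\<lambda>z. z - u) has_vector_derivative 1) (at z within T)"
      unfolding has_real_derivative_iff_has_vector_derivative[symmetric]
      by (auto intro!: derivative_eq_intros)
    then have lin: "((\<lambda>z. (z - u) *\<^sub>R f' u) has_vector_derivative 1 *\<^sub>R f' u) (at z within T)"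
      by (rule bounded_linear.has_vector_derivative[OF bounded_linear_scaleR_left])
    have "(f has_vector_derivative f' z) (at z within T)"
      by (rule has_vector_derivative_within_subset[OF f that(2)]) (use that in blast)
    from has_vector_derivative_diff[OF this lin] show ?thesis
      unfolding g_def by (simp only: scaleR_one)
  qed
  have le: "norm (f' z - f' u) \<le> M * \<bar>z - u\<bar>" if "z \<in> {a..b}" for z
    by (rule norm_diff_le_of_deriv_bounded[OF f' M u that])
  have q: "((\<lambda>z. c * ((z - u)\<^sup>2 / 2)) has_vector_derivative c * (z - u)) (at z within T)" for z T c
    unfolding has_real_derivative_iff_has_vector_derivative[symmetric]
    by (auto intro!: derivative_eq_intros)
  have "norm (g y - g u) \<le> M * (y - u)\<^sup>2 / 2"
  proof (cases "u \<le> y")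
    case True
    have T: "{u..y} \<subseteq> {a..b}"
      using u y by auto
    have "norm (g y - g u) \<le> M * ((y - u)\<^sup>2 / 2) - M * ((u - u)\<^sup>2 / 2)"
    proof (rule norm_diff_le_of_deriv_le[OF True g[OF _ T] q])
      show "norm (f' z - f' u) \<le> M * (z - u)" if "z \<in> {u..y}" for z
        using le[of z] that T by (auto simp: abs_of_nonneg)
    qed
    then show ?thesis
      by simp
  next
    case False
    then have yu: "y \<le> u"
      by simp
    have T: "{y..u} \<subseteq> {a..b}"
      using u y by auto
    \<comment> \<open>To the left of \<open>u\<close> one has
      \<open>\<bar>z - u\<bar> = - (z - u)\<close>, hence the comparison function with
      \<open>- M\<close>.\<close>
    have "norm (g u - g y) \<le> - M * ((u - u)\<^sup>2 / 2) - - M * ((y - u)\<^sup>2 / 2)"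
    proof (rule norm_diff_le_of_deriv_le[OF yu g[OF _ T] q])
      show "norm (f' z - f' u) \<le> - M * (z - u)" if "z \<in> {y..u}" for z
        using le[of z] that T by (auto simp: abs_of_nonpos algebra_simps)
    qed
    then show ?thesis
      by (simp add: norm_minus_commute)
  qed
  moreover have "g y - g u = f y - (f u + (y - u) *\<^sub>R f' u)"
    by (simp add: g_def)
  ultimately show ?thesis
    by simp
qed

section \<open>Moments of the Bernstein weights and bounds for the constants\<close>

text \<open>Variance of a binomial distribution plus the squared distance of its mean
  \<open>n * u\<close> from \<open>v\<close>, found by expanding in factorial moments.\<close>

lemma sum_Bernstein_square_dev:
  "(\<Sum>j\<le>n. Bernstein n j u * (real j - v)\<^sup>2) = real n * u * (1 - u) + (real n * u - v)\<^sup>2"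
proof -
  have "(\<Sum>j\<le>n. Bernstein n j u * (real j - v)\<^sup>2) =
      (\<Sum>j\<le>n. real j * (real j - 1) * Bernstein n j u + (1 - 2 * v) * (real j * Bernstein n j u)
        + v\<^sup>2 * Bernstein n j u)"
    by (intro sum.cong refl) (simp add: power2_eq_square algebra_simps)
  also have "\<dots> = real n * (real n - 1) * u\<^sup>2 + (1 - 2 * v) * (real n * u) + v\<^sup>2"
    by (simp add: sum.distrib sum_distrib_left[symmetric])
  finally show ?thesis
    by (simp add: power2_eq_square algebra_simps)
qed

text \<open>For \<open>r \<le> N\<close>, \<open>\<kappa> r\<close> is the product of the factors
  \<open>1 - i / N\<close>, so its distance from 1 is at most the sum of the \<open>i / N\<close>
  with \<open>i < r\<close>. Beyond \<open>N\<close> the same induction works, because truncation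
  only enlarges \<open>N - r\<close>.\<close>

lemma falling_factorial_ratio_bounds:
  assumes "1 \<le> N"
  defines "\<kappa> \<equiv> \<lambda>r. (\<Prod>i<r. real (N - i)) / real N ^ r"
  shows "0 \<le> \<kappa> r" "\<kappa> r \<le> 1" "1 - \<kappa> r \<le> real r * (real r - 1) / (2 * real N)"
proof -
  have nonneg: "0 \<le> \<kappa> r" for r
    unfolding \<kappa>_def by (simp add: prod_nonneg)
  have step: "\<kappa> (Suc r) = \<kappa> r * (real (N - r) / real N)" for r
    unfolding \<kappa>_def by (simp add: mult.commute)
  have le1: "\<kappa> r \<le> 1" for r
  proof (induction r)
    case 0
    show ?case by (simp add: \<kappa>_def)
  next
    case (Suc r)
    have "\<kappa> r * (real (N - r) / real N) \<le> 1 * 1"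
      using Suc nonneg[of r] assms(1) by (intro mult_mono) auto
    then show ?case
      by (simp add: step)
  qed
  have "1 - \<kappa> r \<le> real r * (real r - 1) / (2 * real N)"
  proof (induction r)
    case 0
    show ?case by (simp add: \<kappa>_def)
  next
    case (Suc r)
    have "1 - real r / real N = (real N - real r) / real N"
      using assms(1) by (simp add: field_simps)
    also have "\<dots> \<le> real (N - r) / real N"
      by (intro divide_right_mono) auto
    finally have "1 - real r / real N \<le> real (N - r) / real N" .
    then have "\<kappa> r * (1 - real r / real N) \<le> \<kappa> (Suc r)"
      unfolding step using nonneg[of r] by (intro mult_left_mono)
    moreover have "\<kappa> r * (real r / real N) \<le> 1 * (real r / real N)"
      using le1[of r] by (intro mult_right_mono) auto
    ultimately have "1 - \<kappa> (Suc r) \<le> real r * (real r - 1) / (2 * real N) + real r / real N"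
      using Suc by (simp add: algebra_simps)
    also have "\<dots> = real (Suc r) * (real (Suc r) - 1) / (2 * real N)"
      using assms(1) by (simp add: field_simps)
    finally show ?case .
  qed
  with nonneg le1 show "0 \<le> \<kappa> r" "\<kappa> r \<le> 1" "1 - \<kappa> r \<le> real r * (real r - 1) / (2 * real N)"
    by auto
qed

text \<open>With \<open>q = u * (1 - u)\<close> the left side is
  \<open>(N - r) * 2 q + r^2 (1 - 2 q)\<close>. Splitting \<open>N\<close> into \<open>N - r\<close>
  and \<open>r\<close>, the first part follows from \<open>q \<le> 1/4\<close>, the second from
  \<open>r (r - 1) (r - 2) \<ge> 0\<close>, which holds because \<open>r\<close> is an
  integer.\<close>

lemma node_spread_le:
  fixes u :: real
  assumes "1 \<le> r" "r \<le> N" "0 \<le> u" "u \<le> 1"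
  shows "2 * real (N - r) * u * (1 - u) + (real r)\<^sup>2 * (u\<^sup>2 + (1 - u)\<^sup>2)
           \<le> real N * (((real r)\<^sup>2 - real r + 2) / 2)"
proof -
  define q where "q = u * (1 - u)"
  have "0 \<le> q"
    unfolding q_def using assms by simp
  have "0 \<le> (u - 1/2)\<^sup>2"
    by simp
  then have q: "q \<le> 1/4"
    unfolding q_def by (simp add: power2_eq_square algebra_simps)
  have rr: "0 \<le> (real r - 1) * (real r - 2)"
    using assms(1) by (cases "r = 1") auto
  have "real r \<ge> 1"
    using assms(1) by simp
  then have "real r * 1 \<le> real r * real r"
    by (intro mult_left_mono) auto
  then have "2 * q \<le> ((real r)\<^sup>2 - real r + 2) / 2"
    using q by (simp add: power2_eq_square)
  then have "real (N - r) * (2 * q) \<le> real (N - r) * (((real r)\<^sup>2 - real r + 2) / 2)"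
    by (intro mult_left_mono) auto
  moreover have "(real r)\<^sup>2 * (1 - 2 * q) \<le> (real r)\<^sup>2 * 1"
    using \<open>0 \<le> q\<close> by (intro mult_left_mono) auto
  moreover have "(real r)\<^sup>2 \<le> real r * (((real r)\<^sup>2 - real r + 2) / 2)"
  proof -
    have "0 \<le> real r * ((real r - 1) * (real r - 2))"
      by (rule mult_nonneg_nonneg[OF of_nat_0_le_iff rr])
    then show ?thesis
      by (simp add: power2_eq_square algebra_simps)
  qed
  moreover have "real N * c = real (N - r) * c + real r * c" for c
    using assms(2) by (simp add: of_nat_diff algebra_simps)
  note this[of "((real r)\<^sup>2 - real r + 2) / 2"]
  ultimately have "real (N - r) * (2 * q) + (real r)\<^sup>2 * (1 - 2 * q) \<le> real N * (((real r)\<^sup>2 - real r + 2) / 2)"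
    by linarith
  moreover have "u\<^sup>2 + (1 - u)\<^sup>2 = 1 - 2 * q"
    by (simp add: q_def power2_eq_square algebra_simps)
  moreover have "2 * real (N - r) * u * (1 - u) = real (N - r) * (2 * q)"
    by (simp add: q_def)
  ultimately show ?thesis
    by (simp only:)
qed


section \<open>The error on one segment\<close>

text \<open>The derivatives enter as an explicit chain \<open>D\<close>, so that derivatives within
  a larger interval can be used after restriction. The error splits into the deviation from
  \<open>\<kappa> (G + w G')\<close>, the drift \<open>\<kappa> w G'\<close> and the defect
  \<open>(1 - \<kappa>) G\<close>.\<close>

lemma bernstein_approx_nth_deriv_error:
  fixes D :: "nat \<Rightarrow> real \<Rightarrow> 'a::real_normed_vector"
  assumes "a < b" "1 \<le> N" "1 \<le> r"
    and D: "\<And>i y. i < r + 2 \<Longrightarrow> y \<in> {a..b} \<Longrightarrow> (D i has_vector_derivative D (Suc i) y) (at y within {a..b})"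
    and M: "\<And>y. y \<in> {a..b} \<Longrightarrow> norm (D (r + 2) y) \<le> M"
    and t: "t \<in> {a..b}"
  shows "norm (nth_deriv_on r {a..b} (bernstein_approx (D 0) a b N) t - D r t)
    \<le> ((b - a)\<^sup>2 * ((real r)\<^sup>2 + 1) / 2 * M + (b - a) * (real r)\<^sup>2 / 2 * norm (D (r + 1) a)
        + real r * (real r - 1) / 2 * norm (D r a)) / real N"
proof -
  define h \<delta> u n where "h = b - a" and "\<delta> = h / real N" and "u = (t - a) / h" and "n = N - r"
  define \<kappa> where "\<kappa> = (\<Prod>i<r. real (N - i)) / real N ^ r"
  define G G' where "G = D r t" and "G' = D (r + 1) t"
  \<comment> \<open>Weighted mean of the displacement from \<open>t\<close> of the midpoints of the
    blocks of \<open>r + 1\<close> consecutive nodes.\<close>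
  define w where "w = \<delta> * real r * (1 / 2 - u)"
  define V where "V = 2 * real n * u * (1 - u) + (real r)\<^sup>2 * (u\<^sup>2 + (1 - u)\<^sup>2)"
  define d where "d = (fwd_diff ^^ r) (\<lambda>j. D 0 (a + real j * \<delta>))"
  define X where "X = nth_deriv_on r {a..b} (bernstein_approx (D 0) a b N) t"
  have N: "0 < real N" and h: "0 < h"
    using assms(1,2) by (auto simp: h_def)
  have \<delta>: "0 < \<delta>" "real N * \<delta> = h"
    using N h by (auto simp: \<delta>_def)
  have u: "0 \<le> u" "u \<le> 1" "t = a + h * u"
    using t h by (auto simp: u_def h_def)
  have "a \<in> {a..b}"
    using assms(1) by simp
  have M0: "0 \<le> M"
    using M[OF t] norm_ge_zero[of "D (r + 2) t"] by linarith
  have \<kappa>: "0 \<le> \<kappa>" "\<kappa> \<le> 1" "1 - \<kappa> \<le> real r * (real r - 1) / (2 * real N)"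
    unfolding \<kappa>_def by (rule falling_factorial_ratio_bounds[OF assms(2)])+
  have nodes: "(\<lambda>j. D 0 (a + real j / real N * (b - a))) = (\<lambda>j. D 0 (a + real j * \<delta>))"
    by (simp add: \<delta>_def h_def)
  have X: "X = ((\<Prod>i<r. real (N - i)) / h ^ r) *\<^sub>R bernstein_form n d u"
    unfolding X_def nth_deriv_on_bernstein_approx[OF assms(1) t] nodes
    by (simp add: h_def n_def d_def u_def)
  \<comment> \<open>The factor \<open>\<kappa>\<close> stays in front of \<open>V\<close> to cover
    \<open>N < r\<close>, where \<open>\<kappa> = 0\<close> and \<open>X = 0\<close> but
    \<open>V\<close> alone may exceed the bound.\<close>
  have V: "\<kappa> * V \<le> real N * (((real r)\<^sup>2 - real r + 2) / 2) \<and>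
      norm (X - \<kappa> *\<^sub>R (G + w *\<^sub>R G')) \<le> \<kappa> * (M / 2 * \<delta>\<^sup>2 * V)"
  proof (cases "r \<le> N")
    case False
    then have "(\<Prod>i<r. real (N - i)) = 0"
      by (intro prod_zero) (auto intro!: bexI[of _ N])
    then have "\<kappa> = 0" "X = 0"
      unfolding X \<kappa>_def by (simp_all only: div_0 scaleR_zero_left)
    moreover have "0 \<le> (real r - 1) * (real r - 1) + real r + 1"
      by (intro add_nonneg_nonneg) auto
    then have "0 \<le> (real r)\<^sup>2 - real r + 2"
      by (simp add: power2_eq_square algebra_simps)
    ultimately show ?thesis
      using N by simp
  next
    case True
    then have n: "real n = real N - real r"
      by (simp add: n_def of_nat_diff)
    have "\<kappa> * V \<le> 1 * V"
      using \<kappa> u by (intro mult_right_mono) (auto simp: V_def)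
    also have "\<dots> \<le> real N * (((real r)\<^sup>2 - real r + 2) / 2)"
      unfolding V_def n_def using node_spread_le[OF assms(3) True u(1,2)] by simp
    finally have 1: "\<kappa> * V \<le> real N * (((real r)\<^sup>2 - real r + 2) / 2)" .
    define p where "p j = a + real j * \<delta>" for j
    define A where "A j = G + (p j - t) *\<^sub>R G'" for j
    \<comment> \<open>In units of \<open>\<delta>\<close>, the point \<open>t\<close> lies
      \<open>N * u\<close> to the right of \<open>a\<close>; \<open>j - v1\<close> and
      \<open>j - v2\<close> are then the offsets from \<open>t\<close> of the left and right ends of
      the block starting at node \<open>j\<close>.\<close>
    define v1 v2 where "v1 = real N * u" and "v2 = real N * u - real r"
    define E where "E j = M / 2 * \<delta>\<^sup>2 * ((real j - v1)\<^sup>2 + (real j - v2)\<^sup>2)" for j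
    have pt: "p j - t = \<delta> * (real j - v1)" "p j + real r * \<delta> - t = \<delta> * (real j - v2)" for j
      using \<delta>(2) by (simp_all add: p_def u(3) v1_def v2_def algebra_simps)
    have d: "norm (d j - \<delta> ^ r *\<^sub>R (A j + (real r * \<delta> / 2) *\<^sub>R G')) \<le> \<delta> ^ r * E j" if j: "j \<le> n" for j
    proof -
      have "real j + real r \<le> real N"
        using j n by (simp add: of_nat_le_iff[symmetric, where 'a = real] del: of_nat_le_iff)
      then have "(real j + real r) * \<delta> \<le> real N * \<delta>"
        using \<delta> by (intro mult_right_mono) auto
      then have sub: "{p j..p j + real r * \<delta>} \<subseteq> {a..b}"
        using \<delta> by (auto simp: p_def h_def algebra_simps intro: order_trans)
      show ?thesis
        unfolding d_def
      proof (rule fwd_diff_funpow_approx[OF \<delta>(1) p_def])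
        show "(D i has_vector_derivative D (Suc i) y) (at y within {p j..p j + real r * \<delta>})"
          if "i < r" "y \<in> {p j..p j + real r * \<delta>}" for i y
          by (rule has_vector_derivative_within_subset[OF D sub]) (use that sub in auto)
        show "norm (D r y - (A j + (y - p j) *\<^sub>R G')) \<le> E j"
          if y: "y \<in> {p j..p j + real r * \<delta>}" for y
        proof -
          have "norm (D r y - (D r t + (y - t) *\<^sub>R D (r + 1) t)) \<le> M * (y - t)\<^sup>2 / 2"
            by (rule norm_taylor_remainder_le[where f'' = "D (r + 2)" and a = a and b = b])
               (use D[of r] D[of "r + 1"] M t y sub in auto)
          \<comment> \<open>The block end on the far side of \<open>y\<close>, seen from
            \<open>t\<close>, is at least as distant as \<open>y\<close>. Adding both squares avoids
            knowing which end it is and leaves computable moments.\<close>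
          moreover have "(y - t)\<^sup>2 \<le> (p j - t)\<^sup>2 + (p j + real r * \<delta> - t)\<^sup>2"
          proof (cases "y \<le> t")
            case True
            then have "(y - t)\<^sup>2 \<le> (p j - t)\<^sup>2"
              using y by (simp add: abs_le_square_iff[symmetric])
            then show ?thesis
              by (simp add: add_increasing2)
          next
            case False
            then have "(y - t)\<^sup>2 \<le> (p j + real r * \<delta> - t)\<^sup>2"
              using y by (simp add: abs_le_square_iff[symmetric])
            then show ?thesis
              by (simp add: add_increasing)
          qed
          then have "M * (y - t)\<^sup>2 / 2 \<le> E j"
            using mult_left_mono[OF _ M0, of "(y - t)\<^sup>2" "(p j - t)\<^sup>2 + (p j + real r * \<delta> - t)\<^sup>2"]
            unfolding E_def pt power_mult_distrib by (simp add: algebra_simps)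
          moreover have "A j + (y - p j) *\<^sub>R G' = D r t + (y - t) *\<^sub>R D (r + 1) t"
            unfolding A_def G_def G'_def by (simp add: scaleR_diff_left)
          ultimately show ?thesis
            by (simp only:)
        qed
      qed
    qed
    let ?B = "\<lambda>j. Bernstein n j u"
    have B0: "0 \<le> ?B j" for j
      by (rule Bernstein_nonneg[OF u(1,2)])
    have "A j + (real r * \<delta> / 2) *\<^sub>R G' = G + (\<delta> * (real j - (v1 - real r / 2))) *\<^sub>R G'" for j
      unfolding A_def pt by (simp add: algebra_simps)
    moreover have "(\<Sum>j\<le>n. ?B j * (\<delta> * (real j - (v1 - real r / 2)))) = w"
    proof -
      have "(\<Sum>j\<le>n. ?B j * (\<delta> * (real j - (v1 - real r / 2)))) =
          (\<Sum>j\<le>n. \<delta> * (real j * ?B j) - \<delta> * (v1 - real r / 2) * ?B j)"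
        by (intro sum.cong refl) (simp add: algebra_simps)
      also have "\<dots> = \<delta> * (real n * u) - \<delta> * (v1 - real r / 2)"
        by (simp add: sum_subtractf sum_distrib_left[symmetric])
      also have "\<dots> = w"
        by (simp add: n v1_def w_def algebra_simps)
      finally show ?thesis .
    qed
    ultimately have mean: "(\<Sum>j\<le>n. ?B j *\<^sub>R \<delta> ^ r *\<^sub>R (A j + (real r * \<delta> / 2) *\<^sub>R G')) =
        \<delta> ^ r *\<^sub>R (G + w *\<^sub>R G')"
    proof -
      assume 2: "\<And>j. A j + (real r * \<delta> / 2) *\<^sub>R G' = G + (\<delta> * (real j - (v1 - real r / 2))) *\<^sub>R G'"
        and 3: "(\<Sum>j\<le>n. ?B j * (\<delta> * (real j - (v1 - real r / 2)))) = w"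
      have "(\<Sum>j\<le>n. ?B j *\<^sub>R \<delta> ^ r *\<^sub>R (A j + (real r * \<delta> / 2) *\<^sub>R G')) =
          \<delta> ^ r *\<^sub>R (\<Sum>j\<le>n. ?B j *\<^sub>R G + (?B j * (\<delta> * (real j - (v1 - real r / 2)))) *\<^sub>R G')"
        unfolding 2 scaleR_sum_right
        by (intro sum.cong refl) (simp only: scaleR_add_right scaleR_scaleR ac_simps)
      also have "\<dots> = \<delta> ^ r *\<^sub>R (G + w *\<^sub>R G')"
        by (simp only: sum.distrib scaleR_sum_left[symmetric] 3 sum_Bernstein scaleR_one)
      finally show ?thesis .
    qed
    have spread: "(\<Sum>j\<le>n. ?B j * (\<delta> ^ r * E j)) = \<delta> ^ r * (M / 2 * \<delta>\<^sup>2 * V)"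
    proof -
      have "(\<Sum>j\<le>n. ?B j * (\<delta> ^ r * E j)) = \<delta> ^ r * (M / 2 * \<delta>\<^sup>2 *
          ((\<Sum>j\<le>n. ?B j * (real j - v1)\<^sup>2) + (\<Sum>j\<le>n. ?B j * (real j - v2)\<^sup>2)))"
        unfolding E_def sum.distrib[symmetric] sum_distrib_left
        by (intro sum.cong refl) (simp add: algebra_simps)
      \<comment> \<open>As \<open>n - N = - r\<close>, the mean \<open>n * u\<close> differs from
        \<open>v1\<close> and \<open>v2\<close> by \<open>- r * u\<close> and
        \<open>r * (1 - u)\<close>; these give the two squares in \<open>V\<close>.\<close>
      also have "(\<Sum>j\<le>n. ?B j * (real j - v1)\<^sup>2) + (\<Sum>j\<le>n. ?B j * (real j - v2)\<^sup>2) = V"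
        unfolding sum_Bernstein_square_dev V_def v1_def v2_def n
        by (simp add: power2_eq_square algebra_simps)
      finally show ?thesis .
    qed
    have "norm (bernstein_form n d u - \<delta> ^ r *\<^sub>R (G + w *\<^sub>R G'))
        = norm (\<Sum>j\<le>n. ?B j *\<^sub>R (d j - \<delta> ^ r *\<^sub>R (A j + (real r * \<delta> / 2) *\<^sub>R G')))"
      unfolding mean[symmetric] bernstein_form_def by (simp only: scaleR_diff_right sum_subtractf)
    also have "\<dots> \<le> (\<Sum>j\<le>n. ?B j * (\<delta> ^ r * E j))"
    proof (rule sum_norm_le)
      show "norm (?B j *\<^sub>R (d j - \<delta> ^ r *\<^sub>R (A j + (real r * \<delta> / 2) *\<^sub>R G'))) \<le> ?B j * (\<delta> ^ r * E j)"
        if "j \<in> {..n}" for j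
        using mult_left_mono[OF d B0] that by (simp only: norm_scaleR abs_of_nonneg[OF B0] atMost_iff)
    qed
    finally have core: "norm (bernstein_form n d u - \<delta> ^ r *\<^sub>R (G + w *\<^sub>R G')) \<le> \<delta> ^ r * (M / 2 * \<delta>\<^sup>2 * V)"
      unfolding spread .
    \<comment> \<open>Prefactor of the \<open>r\<close>-th derivative; since
      \<open>h = N * \<delta>\<close>, it turns the scale \<open>\<delta> ^ r\<close> of the
      differences into \<open>\<kappa>\<close>.\<close>
    define c where "c = (\<Prod>i<r. real (N - i)) / h ^ r"
    have c: "0 \<le> c" "c * \<delta> ^ r = \<kappa>"
      using h by (auto simp: c_def \<kappa>_def \<delta>_def power_divide intro!: prod_nonneg divide_nonneg_nonneg)
    have "X - \<kappa> *\<^sub>R (G + w *\<^sub>R G') = c *\<^sub>R (bernstein_form n d u - \<delta> ^ r *\<^sub>R (G + w *\<^sub>R G'))"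
      unfolding X c_def[symmetric] c(2)[symmetric] by (simp only: scaleR_diff_right scaleR_scaleR)
    then have "norm (X - \<kappa> *\<^sub>R (G + w *\<^sub>R G')) \<le> c * (\<delta> ^ r * (M / 2 * \<delta>\<^sup>2 * V))"
      using mult_left_mono[OF core c(1)] by (simp only: norm_scaleR abs_of_nonneg[OF c(1)])
    with 1 show ?thesis
      by (simp only: c(2)[symmetric] mult.assoc)
  qed
  have ta: "0 \<le> t - a" "t - a \<le> h"
    using t by (auto simp: h_def)
  \<comment> \<open>\<open>G'\<close> and then \<open>G\<close> are moved to the left end of the
    segment, where the target constants are evaluated.\<close>
  have "norm (G' - D (r + 1) a) \<le> M * \<bar>t - a\<bar>"
    unfolding G'_def
    by (rule norm_diff_le_of_deriv_bounded[OF _ _ \<open>a \<in> {a..b}\<close> t, where f' = "D (r + 2)"])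
       (use D[of "r + 1"] M in auto)
  also have "\<dots> \<le> M * h"
    using ta M0 by (intro mult_left_mono) auto
  finally have G': "norm G' \<le> norm (D (r + 1) a) + M * h"
    using norm_triangle_sub[of G' "D (r + 1) a"] by linarith
  have "norm (G - (D r a + (t - a) *\<^sub>R D (r + 1) a)) \<le> M * (t - a)\<^sup>2 / 2"
    unfolding G_def
    by (rule norm_taylor_remainder_le[where f'' = "D (r + 2)" and a = a and b = b])
       (use D[of r] D[of "r + 1"] M t assms(1) in auto)
  also have "\<dots> \<le> M * h\<^sup>2 / 2"
    using ta M0 by (intro divide_right_mono mult_left_mono power_mono) auto
  finally have "norm G \<le> norm (D r a + (t - a) *\<^sub>R D (r + 1) a) + M * h\<^sup>2 / 2"
    using norm_triangle_sub[of G "D r a + (t - a) *\<^sub>R D (r + 1) a"] by linarith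
  moreover have "norm (D r a + (t - a) *\<^sub>R D (r + 1) a) \<le> norm (D r a) + h * norm (D (r + 1) a)"
    using ta by (intro norm_triangle_le add_left_mono) (simp add: mult_right_mono)
  ultimately have G: "norm G \<le> norm (D r a) + h * norm (D (r + 1) a) + M * h\<^sup>2 / 2"
    by linarith
  define s where "s = real r * (real r - 1) / (2 * real N)"
  have "norm (X - G) \<le> norm (X - \<kappa> *\<^sub>R (G + w *\<^sub>R G')) + norm (\<kappa> *\<^sub>R w *\<^sub>R G' - (1 - \<kappa>) *\<^sub>R G)"
    by (rule order_trans[OF _ norm_triangle_ineq]) (simp add: algebra_simps)
  also have "\<dots> \<le> norm (X - \<kappa> *\<^sub>R (G + w *\<^sub>R G')) + (norm (\<kappa> *\<^sub>R w *\<^sub>R G') + norm ((1 - \<kappa>) *\<^sub>R G))"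
    by (intro add_left_mono norm_triangle_ineq4)
  \<comment> \<open>The coefficients are tight against the target. For \<open>h^2 M / N\<close>,
    removing the shares \<open>r/2\<close> and \<open>r (r - 1)/4\<close> of the last two summands
    from \<open>(r^2 + 1)/2\<close> leaves \<open>(r^2 - r + 2)/4\<close>; for
    \<open>norm (D (r + 1) a)\<close>, \<open>r + r (r - 1) = r^2\<close>.\<close>
  also have "\<dots> \<le> h\<^sup>2 * M / (2 * real N) * (((real r)\<^sup>2 - real r + 2) / 2)
      + (h * real r / (2 * real N) * (norm (D (r + 1) a) + M * h)
      + s * (norm (D r a) + h * norm (D (r + 1) a) + M * h\<^sup>2 / 2))"
  proof (intro add_mono)
    have "M / 2 * \<delta>\<^sup>2 * (\<kappa> * V) \<le> M / 2 * \<delta>\<^sup>2 * (real N * (((real r)\<^sup>2 - real r + 2) / 2))"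
      using V M0 by (intro mult_left_mono) auto
    also have "\<dots> = h\<^sup>2 * M / (2 * real N) * (((real r)\<^sup>2 - real r + 2) / 2)"
      using N by (simp add: \<delta>_def power2_eq_square)
    finally show "norm (X - \<kappa> *\<^sub>R (G + w *\<^sub>R G')) \<le> h\<^sup>2 * M / (2 * real N) * (((real r)\<^sup>2 - real r + 2) / 2)"
      using V unfolding mult.left_commute[of \<kappa>] by linarith
    have "\<bar>1 / 2 - u\<bar> \<le> 1 / 2"
      using u(1,2) by linarith
    then have "\<bar>w\<bar> \<le> \<delta> * real r * (1 / 2)"
      unfolding w_def abs_mult using \<delta>(1) by (intro mult_mono) auto
    then have "\<kappa> * \<bar>w\<bar> \<le> 1 * (\<delta> * real r * (1 / 2))"
      using \<kappa> by (intro mult_mono) auto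
    then have "\<kappa> * \<bar>w\<bar> \<le> h * real r / (2 * real N)"
      by (simp add: \<delta>_def)
    then have "\<kappa> * \<bar>w\<bar> * norm G' \<le> h * real r / (2 * real N) * (norm (D (r + 1) a) + M * h)"
      using G' h by (intro mult_mono) auto
    then show "norm (\<kappa> *\<^sub>R w *\<^sub>R G') \<le> h * real r / (2 * real N) * (norm (D (r + 1) a) + M * h)"
      using \<kappa> by (simp add: abs_mult)
    have "0 \<le> s"
      unfolding s_def using assms(3) by auto
    then show "norm ((1 - \<kappa>) *\<^sub>R G) \<le> s * (norm (D r a) + h * norm (D (r + 1) a) + M * h\<^sup>2 / 2)"
      using \<kappa> G unfolding norm_scaleR by (intro mult_mono) (auto simp: s_def)
  qed
  also have "\<dots> = (h\<^sup>2 * ((real r)\<^sup>2 + 1) / 2 * M + h * (real r)\<^sup>2 / 2 * norm (D (r + 1) a)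
        + real r * (real r - 1) / 2 * norm (D r a)) / real N"
    using N by (simp add: s_def power2_eq_square field_simps)
  finally show ?thesis
    by (simp only: X_def G_def h_def)
qed

section \<open>The composite approximant\<close>

text \<open>Fixing \<open>\<beta>1\<close>, \<open>\<beta>2\<close>, \<open>\<beta>3\<close> before
  \<open>K\<close>, \<open>N\<close> and the knots expresses independence. The maxima in
  \<open>B2_const\<close> and \<open>B3_const\<close> vary with the knots and are only bounded. At
  an interior knot both adjacent segments are covered.\<close>

theorem lemma2:
  fixes x :: "real \<Rightarrow> 'a::euclidean_space" and tf Ct :: real and r :: nat
  assumes "0 < tf" and "0 < Ct" and "1 \<le> r"
    and "Ck_on (r + 2) {0..tf} x"
  shows "\<exists>\<beta>1 \<beta>2 \<beta>3 :: real. \<forall>(K::nat) (N::nat) (\<tau> :: nat \<Rightarrow> real).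
           time_knots tf Ct K \<tau> \<and> 1 \<le> N \<longrightarrow>
             B1_const x tf Ct K \<tau> r = \<beta>1 \<and> B2_const x tf Ct K \<tau> r \<le> \<beta>2 \<and> B3_const x tf K \<tau> r \<le> \<beta>3 \<and>
             (\<forall>t\<in>{0..tf}. \<forall>k\<in>{1..K}. t \<in> segment \<tau> k \<longrightarrow>
                norm (nth_deriv_on r (segment \<tau> k) (composite_bernstein x \<tau> K N) t
                      - nth_deriv_on r {0..tf} x t)
                \<le> B1_const x tf Ct K \<tau> r / (real K ^ 2 * real N)
                  + B2_const x tf Ct K \<tau> r / (real K * real N)
                  + B3_const x tf K \<tau> r / real N)"
proof -
  define D where "D i = nth_deriv_on i {0..tf} x" for i
  have D: "(D i has_vector_derivative D (Suc i) y) (at y within {0..tf})"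
    if "i < r + 2" "y \<in> {0..tf}" for i y
    using assms(4) that by (simp add: Ck_on_def D_def vector_derivative_works[symmetric])
  have cont: "continuous_on {0..tf} (D i)" if "i \<le> r + 2" for i
  proof (cases "i = r + 2")
    case True
    then show ?thesis
      using assms(4) by (simp add: Ck_on_def D_def)
  next
    case False
    then show ?thesis
      using that D[of i] by (intro continuous_on_vector_derivative[of _ _ "D (Suc i)"]) auto
  qed
  \<comment> \<open>Suprema over the whole time interval do not depend on the partition and supply
    the witnesses; \<open>B1_const\<close> attains its witness because the segments cover
    \<open>{0..tf}\<close>.\<close>
  define S where "S i = (SUP s\<in>{0..tf}. norm (D i s))" for i
  have S: "norm (D i s) \<le> S i" if "i \<le> r + 2" "s \<in> {0..tf}" for i s
  proof -
    have "compact ((\<lambda>s. norm (D i s)) ` {0..tf})"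
      by (intro compact_continuous_image continuous_on_norm cont that) auto
    then show ?thesis
      unfolding S_def by (intro cSUP_upper that bounded_imp_bdd_above compact_imp_bounded)
  qed
  have "B1_const x tf Ct K \<tau> r = Ct\<^sup>2 * ((real r)\<^sup>2 + 1) / 2 * S (r + 2) \<and>
      B2_const x tf Ct K \<tau> r \<le> Ct * (real r)\<^sup>2 / 2 * S (r + 1) \<and>
      B3_const x tf K \<tau> r \<le> real r * (real r - 1) / 2 * S r \<and>
      (\<forall>t\<in>{0..tf}. \<forall>k\<in>{1..K}. t \<in> segment \<tau> k \<longrightarrow>
        norm (nth_deriv_on r (segment \<tau> k) (composite_bernstein x \<tau> K N) t - nth_deriv_on r {0..tf} x t)
          \<le> B1_const x tf Ct K \<tau> r / (real K ^ 2 * real N)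
            + B2_const x tf Ct K \<tau> r / (real K * real N) + B3_const x tf K \<tau> r / real N)"
    if kn: "time_knots tf Ct K \<tau>" and N: "1 \<le> N" for K N \<tau>
  proof -
    have K: "1 \<le> K"
      using kn by (simp add: time_knots_def)
    have knot: "\<tau> (k - 1) \<in> {0..tf}" if "k \<in> {1..K}" for k
      using time_knots_mono[OF kn, of 0 "k - 1"] time_knots_mono[OF kn, of "k - 1" K] that kn
      by (auto simp: time_knots_def)
    define m where "m i = (MAX k\<in>{1..K}. norm (D i (\<tau> (k - 1))))" for i
    have m: "norm (D i (\<tau> (k - 1))) \<le> m i" if "k \<in> {1..K}" for i k
      unfolding m_def using that by (intro Max_ge) auto
    have mS: "m i \<le> S i" if "i \<le> r + 2" for i
      unfolding m_def using K S[OF that knot] by (intro Max.boundedI) auto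
    have rr: "0 \<le> real r * (real r - 1) / 2"
      using assms(3) by auto
    have B1: "B1_const x tf Ct K \<tau> r = Ct\<^sup>2 * ((real r)\<^sup>2 + 1) / 2 * S (r + 2)"
      unfolding B1_const_def time_knots_segments_cover[OF kn] S_def D_def ..
    have B2: "B2_const x tf Ct K \<tau> r = Ct * (real r)\<^sup>2 / 2 * m (r + 1)"
      unfolding B2_const_def m_def D_def ..
    have B3: "B3_const x tf K \<tau> r = real r * (real r - 1) / 2 * m r"
      unfolding B3_const_def m_def D_def ..
    have "norm (nth_deriv_on r (segment \<tau> k) (composite_bernstein x \<tau> K N) t - nth_deriv_on r {0..tf} x t)
          \<le> B1_const x tf Ct K \<tau> r / (real K ^ 2 * real N)
            + B2_const x tf Ct K \<tau> r / (real K * real N) + B3_const x tf K \<tau> r / real N"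
      if k: "k \<in> {1..K}" and t: "t \<in> segment \<tau> k" for t k
    proof -
      define a b where "a = \<tau> (k - 1)" and "b = \<tau> k"
      have ab: "a < b" "b - a \<le> Ct / real K"
        using kn k unfolding time_knots_def a_def b_def by force+
      have sub: "{a..b} \<subseteq> {0..tf}"
        using time_knots_segments_cover[OF kn] k unfolding segment_def a_def b_def by blast
      have S0: "0 \<le> S (r + 2)"
        using order_trans[OF norm_ge_zero S[of "r + 2" 0]] assms(1) by simp
      have "norm (nth_deriv_on r {a..b} (bernstein_approx (D 0) a b N) t - D r t)
          \<le> ((b - a)\<^sup>2 * ((real r)\<^sup>2 + 1) / 2 * S (r + 2) + (b - a) * (real r)\<^sup>2 / 2 * norm (D (r + 1) a)
              + real r * (real r - 1) / 2 * norm (D r a)) / real N"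
      proof (rule bernstein_approx_nth_deriv_error[OF ab(1) N assms(3)])
        show "(D i has_vector_derivative D (Suc i) y) (at y within {a..b})"
          if "i < r + 2" "y \<in> {a..b}" for i y
          by (rule has_vector_derivative_within_subset[OF D sub]) (use that sub in blast)+
        show "norm (D (r + 2) y) \<le> S (r + 2)" if "y \<in> {a..b}" for y
          by (rule S) (use that sub in blast)+
        show "t \<in> {a..b}"
          using t by (simp add: segment_def a_def b_def)
      qed
      also have "\<dots> \<le> ((Ct / real K)\<^sup>2 * ((real r)\<^sup>2 + 1) / 2 * S (r + 2)
          + (Ct / real K) * (real r)\<^sup>2 / 2 * m (r + 1) + real r * (real r - 1) / 2 * m r) / real N"
      proof (intro divide_right_mono add_mono)
        show "(b - a)\<^sup>2 * ((real r)\<^sup>2 + 1) / 2 * S (r + 2) \<le> (Ct / real K)\<^sup>2 * ((real r)\<^sup>2 + 1) / 2 * S (r + 2)"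
          using ab S0 by (intro mult_right_mono divide_right_mono power_mono) auto
        show "(b - a) * (real r)\<^sup>2 / 2 * norm (D (r + 1) a) \<le> (Ct / real K) * (real r)\<^sup>2 / 2 * m (r + 1)"
          unfolding a_def using ab m[OF k] assms(2)
          by (intro mult_mono divide_right_mono mult_right_mono) (auto simp: a_def b_def)
        show "real r * (real r - 1) / 2 * norm (D r a) \<le> real r * (real r - 1) / 2 * m r"
          unfolding a_def by (rule mult_left_mono[OF m[OF k] rr])
      qed simp
      also have "\<dots> = B1_const x tf Ct K \<tau> r / (real K ^ 2 * real N)
            + B2_const x tf Ct K \<tau> r / (real K * real N) + B3_const x tf K \<tau> r / real N"
        unfolding B1 B2 B3 by (simp add: add_divide_distrib power_divide)
      finally show ?thesis
        using nth_deriv_on_composite_bernstein[OF kn N k t, of r x]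
        by (simp add: D_def a_def b_def segment_def)
    qed
    moreover have "B2_const x tf Ct K \<tau> r \<le> Ct * (real r)\<^sup>2 / 2 * S (r + 1)"
      unfolding B2 using assms(2) by (intro mult_left_mono mS) auto
    moreover have "B3_const x tf K \<tau> r \<le> real r * (real r - 1) / 2 * S r"
      unfolding B3 by (intro mult_left_mono mS rr) auto
    ultimately show ?thesis
      using B1 by blast
  qed
  then show ?thesis
    by blast
qed

end
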